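(* Each infinite group $G$ has $cn(G)\le w_l(G)$.
   Context: A group topology on $G$ is a topology for which $(x,y)\mapsto xy^{-1}$ is jointly continuous; it is linear if it has a neighborhood base at the unit $1_G$ consisting of open subgroups of $G$. The weight $w(G,\tau)$ is the smallest cardinality of a base of $\tau$. The linear weight is $w_l(G)=\min\{w(G,\tau):\tau\text{ is a linear Hausdorff group topology on }G\}$. The weak compatibility number $cn(G)$ is the smallest infinite cardinal $\kappa$ such that $G$ satisfies the weak $\kappa^+$-compatibility condition: for any finite group $F$ and any isomorphisms $f_i:F\to F_i$, $i<\kappa^+$, onto finite subgroups $F_i$ of $G$, there are two indices $i<j<\kappa^+$ and a homomorphism $\phi:\langle F_i\cup F_j\rangle\to F$ such that $\phi\circ f_i=\phi\circ f_j=\mathrm{id}_F$. Here $\kappa^+$ is the successor cardinal of $\kappa$ and $\langle A\rangle$ is the subgroup of $G$ generated by $A$. *)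

theory Defs
  imports "HOL-Analysis.Analysis" "HOL-Algebra.Generated_Groups"
begin

unbundle cardinal_syntax
(* Set_Algebras uses the same infix for set membership, which makes =o ambiguous. *)
no_notation elt_set_eq (infix \<open>=o\<close> 50)

text \<open>A cardinal is an order relation satisfying \<^const>\<open>card_order_on\<close> on its own field, and
  cardinals are compared up to \<open>=o\<close>.  Accordingly, \<open>least_card R\<close> is determined only up to \<open>=o\<close>,
  and it is meaningful when \<open>R\<close> is a nonempty set of cardinals.\<close>

definition least_card :: "'c rel set \<Rightarrow> 'c rel" where
  "least_card R = (SOME r. r \<in> R \<and> (\<forall>s\<in>R. r \<le>o s))"

lemma least_card:
  assumes "R \<noteq> {}" "\<And>r. r \<in> R \<Longrightarrow> Card_order r"
  shows "least_card R \<in> R" "\<And>s. s \<in> R \<Longrightarrow> least_card R \<le>o s"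
proof -
  have "\<exists>r. r \<in> R \<and> (\<forall>s\<in>R. r \<le>o s)"
    using exists_minim_Card_order[of R] assms by blast
  from someI_ex[OF this] show "least_card R \<in> R" "\<And>s. s \<in> R \<Longrightarrow> least_card R \<le>o s"
    unfolding least_card_def by blast+
qed

definition topology_base :: "'a topology \<Rightarrow> 'a set set \<Rightarrow> bool" where
  "topology_base X B \<longleftrightarrow>
     (\<forall>V\<in>B. openin X V) \<and> (\<forall>U x. openin X U \<and> x \<in> U \<longrightarrow> (\<exists>V\<in>B. x \<in> V \<and> V \<subseteq> U))"

definition weight :: "'a topology \<Rightarrow> 'a set rel" where
  "weight X = least_card {|B| | B. topology_base X B}"

definition group_topology :: "('a, 'm) monoid_scheme \<Rightarrow> 'a topology \<Rightarrow> bool" where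
  "group_topology G X \<longleftrightarrow>
     topspace X = carrier G \<and>
     continuous_map (prod_topology X X) X (\<lambda>(x, y). x \<otimes>\<^bsub>G\<^esub> inv\<^bsub>G\<^esub> y)"

definition linear_group_topology :: "('a, 'm) monoid_scheme \<Rightarrow> 'a topology \<Rightarrow> bool" where
  "linear_group_topology G X \<longleftrightarrow>
     group_topology G X \<and>
     (\<forall>U. openin X U \<and> \<one>\<^bsub>G\<^esub> \<in> U \<longrightarrow> (\<exists>H. subgroup H G \<and> openin X H \<and> H \<subseteq> U))"

definition linear_weight :: "('a, 'm) monoid_scheme \<Rightarrow> 'a set rel" where
  "linear_weight G = least_card {weight X | X. linear_group_topology G X \<and> Hausdorff_space X}"

text \<open>The indices \<open>i < \<mu>\<close> are the elements of \<^term>\<open>Field \<mu>\<close>, strictly ordered by \<open>\<mu>\<close>.  Every finite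
  group is isomorphic to one carried by natural numbers, so it suffices that \<open>F\<close> ranges over the
  groups of type \<^typ>\<open>nat monoid\<close>; lemma \<open>weak_compatD\<close> below gives the condition for \<open>F\<close> of any
  type.\<close>

definition weak_compat :: "('a, 'm) monoid_scheme \<Rightarrow> 'i rel \<Rightarrow> bool" where
  "weak_compat G \<mu> \<longleftrightarrow>
     (\<forall>(F :: nat monoid) (S :: 'i \<Rightarrow> 'a set) (f :: 'i \<Rightarrow> nat \<Rightarrow> 'a).
        group F \<and> finite (carrier F) \<and>
        (\<forall>i\<in>Field \<mu>. subgroup (S i) G \<and> finite (S i) \<and>
                      f i \<in> Group.iso F (G\<lparr>carrier := S i\<rparr>)) \<longrightarrow>
        (\<exists>i j \<phi>. (i, j) \<in> \<mu> \<and> i \<noteq> j \<and>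
           \<phi> \<in> hom (G\<lparr>carrier := generate G (S i \<union> S j)\<rparr>) F \<and>
           (\<forall>x\<in>carrier F. \<phi> (f i x) = x \<and> \<phi> (f j x) = x)))"

text \<open>The minimum is taken over the cardinals on the type \<^typ>\<open>'a + nat\<close>, which represents every
  infinite cardinal up to that of \<^term>\<open>UNIV :: 'a set\<close>.  This is no restriction: by lemma
  \<open>compat_number\<close> below, the minimum exists and is least among the cardinals on all types.\<close>

definition compat_number :: "('a, 'm) monoid_scheme \<Rightarrow> ('a + nat) rel" where
  "compat_number G = least_card {\<kappa>. Cinfinite \<kappa> \<and> weak_compat G (cardSuc \<kappa>)}"

lemma weak_compatD:
  fixes F :: "('f, 'n) monoid_scheme"
  assumes wc: "weak_compat G \<mu>" and F: "group F" "finite (carrier F)"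
    and f: "\<And>i. i \<in> Field \<mu> \<Longrightarrow>
      subgroup (S i) G \<and> finite (S i) \<and> f i \<in> Group.iso F (G\<lparr>carrier := S i\<rparr>)"
  shows "\<exists>i j \<phi>. (i, j) \<in> \<mu> \<and> i \<noteq> j \<and>
    \<phi> \<in> hom (G\<lparr>carrier := generate G (S i \<union> S j)\<rparr>) F \<and>
    (\<forall>x\<in>carrier F. \<phi> (f i x) = x \<and> \<phi> (f j x) = x)"
proof -
  interpret F: group F by (rule F)
  obtain e :: "'f \<Rightarrow> nat" where e: "inj_on e (carrier F)"
    using F(2) finite_imp_inj_to_nat_seg by metis
  define d where "d = inv_into (carrier F) e"
  have de: "d (e x) = x" if "x \<in> carrier F" for x
    using that e by (simp add: d_def)
  define F' :: "nat monoid" where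
    "F' = \<lparr>carrier = e ` carrier F, mult = (\<lambda>x y. e (d x \<otimes>\<^bsub>F\<^esub> d y)), one = e \<one>\<^bsub>F\<^esub>\<rparr>"
  have e_iso: "e \<in> Group.iso F F'"
    using e by (auto simp: Group.iso_def hom_def bij_betw_def F'_def de)
  have d_iso: "d \<in> Group.iso F' F"
    unfolding d_def by (rule F.iso_set_sym[OF e_iso])
  have cl: "\<And>x. x \<in> carrier F' \<Longrightarrow> d x \<in> carrier F"
    by (auto simp: F'_def de)
  have "monoid F'"
  proof (rule monoidI)
    fix x y z
    assume "x \<in> carrier F'" "y \<in> carrier F'" "z \<in> carrier F'"
    from this[THEN cl] show "x \<otimes>\<^bsub>F'\<^esub> y \<otimes>\<^bsub>F'\<^esub> z = x \<otimes>\<^bsub>F'\<^esub> (y \<otimes>\<^bsub>F'\<^esub> z)"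
      by (simp add: F'_def de F.m_assoc)
  qed (auto simp: F'_def de)
  then have "group F'"
    using F.iso_imp_group e_iso unfolding is_iso_def by blast
  moreover have "finite (carrier F')"
    using F(2) by (simp add: F'_def)
  moreover have "\<forall>i\<in>Field \<mu>. subgroup (S i) G \<and> finite (S i) \<and>
      f i \<circ> d \<in> Group.iso F' (G\<lparr>carrier := S i\<rparr>)"
    using f iso_set_trans[OF d_iso] by blast
  ultimately have "\<exists>i j \<phi>. (i, j) \<in> \<mu> \<and> i \<noteq> j \<and>
      \<phi> \<in> hom (G\<lparr>carrier := generate G (S i \<union> S j)\<rparr>) F' \<and>
      (\<forall>x\<in>carrier F'. \<phi> ((f i \<circ> d) x) = x \<and> \<phi> ((f j \<circ> d) x) = x)"
    using wc[unfolded weak_compat_def, rule_format, of F' S "\<lambda>i. f i \<circ> d"] by blast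
  then obtain i j \<phi> where ij: "(i, j) \<in> \<mu>" "i \<noteq> j"
    and \<phi>: "\<phi> \<in> hom (G\<lparr>carrier := generate G (S i \<union> S j)\<rparr>) F'"
    and eq: "\<And>x. x \<in> carrier F' \<Longrightarrow> \<phi> (f i (d x)) = x \<and> \<phi> (f j (d x)) = x"
    by auto
  have "d \<in> hom F' F"
    using d_iso by (simp add: Group.iso_def)
  from hom_compose[OF \<phi> this]
  have "d \<circ> \<phi> \<in> hom (G\<lparr>carrier := generate G (S i \<union> S j)\<rparr>) F" .
  moreover have "(d \<circ> \<phi>) (f i x) = x \<and> (d \<circ> \<phi>) (f j x) = x" if "x \<in> carrier F" for x
    using eq[of "e x"] that by (simp add: F'_def de)
  ultimately show ?thesis
    using ij by blast
qed

lemma weak_compat_ordIso: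
  assumes "\<mu> =o \<nu>" "weak_compat G \<mu>"
  shows "weak_compat G \<nu>"
proof -
  obtain h where h: "bij_betw h (Field \<mu>) (Field \<nu>)"
    and mono: "\<And>a b. a \<in> Field \<mu> \<Longrightarrow> b \<in> Field \<mu> \<Longrightarrow> (a, b) \<in> \<mu> \<longleftrightarrow> (h a, h b) \<in> \<nu>"
    using assms(1) by (auto simp: ordIso_def BNF_Wellorder_Embedding.iso_iff2)
  show ?thesis
    unfolding weak_compat_def
  proof (intro allI impI)
    fix F :: "nat monoid" and S :: "'b \<Rightarrow> 'c set" and f
    assume A: "group F \<and> finite (carrier F) \<and>
      (\<forall>i\<in>Field \<nu>. subgroup (S i) G \<and> finite (S i) \<and> f i \<in> Group.iso F (G\<lparr>carrier := S i\<rparr>))"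
    have "\<And>i. i \<in> Field \<mu> \<Longrightarrow> h i \<in> Field \<nu>"
      using h by (auto simp: bij_betw_def)
    then obtain i j \<phi> where ij: "(i, j) \<in> \<mu>" "i \<noteq> j" and
      \<phi>: "\<phi> \<in> hom (G\<lparr>carrier := generate G (S (h i) \<union> S (h j))\<rparr>) F \<and>
        (\<forall>x\<in>carrier F. \<phi> (f (h i) x) = x \<and> \<phi> (f (h j) x) = x)"
      using weak_compatD[OF assms(2), of F "S \<circ> h" "f \<circ> h"] A by auto
    have "i \<in> Field \<mu>" "j \<in> Field \<mu>"
      using ij(1) by (auto simp: Field_def)
    then have "(h i, h j) \<in> \<nu>" "h i \<noteq> h j"
      using ij mono h by (auto simp: bij_betw_def inj_on_def)
    with \<phi> show "\<exists>i j \<phi>. (i, j) \<in> \<nu> \<and> i \<noteq> j \<and>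
        \<phi> \<in> hom (G\<lparr>carrier := generate G (S i \<union> S j)\<rparr>) F \<and>
        (\<forall>x\<in>carrier F. \<phi> (f i x) = x \<and> \<phi> (f j x) = x)"
      by blast
  qed
qed

lemma card_of_lists_length:
  assumes "infinite (UNIV :: 'c set)"
  shows "|{xs :: 'c list. length xs = n}| \<le>o |UNIV :: 'c set|"
proof (induction n)
  case 0
  have "|{xs :: 'c list. length xs = 0}| \<le>o |{undefined :: 'c}|"
    by (rule card_of_ordLeqI[where f = "\<lambda>_. undefined"]) (auto simp: inj_on_def)
  also have "|{undefined :: 'c}| \<le>o |UNIV :: 'c set|"
    by (rule card_of_mono1) simp
  finally show ?case .
next
  case (Suc n)
  have "|{xs :: 'c list. length xs = Suc n}| \<le>o |(UNIV :: 'c set) \<times> {xs :: 'c list. length xs = n}|"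
  proof (rule card_of_ordLeqI[where f = "\<lambda>xs. (hd xs, tl xs)"])
    show "inj_on (\<lambda>xs. (hd xs, tl xs)) {xs :: 'c list. length xs = Suc n}"
      by (rule inj_onI) (metis (mono_tags, lifting) Pair_inject Zero_not_Suc list.expand list.size(3) mem_Collect_eq)
  qed auto
  also have "|(UNIV :: 'c set) \<times> {xs :: 'c list. length xs = n}| \<le>o |UNIV :: 'c set|"
    by (rule card_of_Times_ordLeq_infinite_Field)
       (use assms Suc.IH in \<open>simp_all add: Field_card_of card_of_mono1 card_of_card_order_on\<close>)
  finally show ?case .
qed

lemma weak_compat_UNIV:
  fixes G :: "('a, 'm) monoid_scheme"
  assumes "group G"
  shows "weak_compat G (cardSuc |UNIV :: ('a + nat) set| )"
  unfolding weak_compat_def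
proof (intro allI impI)
  interpret group G by fact
  let ?\<mu> = "cardSuc |UNIV :: ('a + nat) set|"
  have co: "Card_order ?\<mu>"
    by (simp add: cardSuc_Card_order card_of_Card_order)
  fix F :: "nat monoid" and S :: "('a + nat) set \<Rightarrow> 'a set" and f
  assume A: "group F \<and> finite (carrier F) \<and>
    (\<forall>i\<in>Field ?\<mu>. subgroup (S i) G \<and> finite (S i) \<and> f i \<in> Group.iso F (G\<lparr>carrier := S i\<rparr>))"
  then obtain xs where xs: "set xs = carrier F"
    using finite_list by blast
  define g where "g i = map (\<lambda>x. Inl (f i x) :: 'a + nat) xs" for i :: "('a + nat) set"
  have "\<not> inj_on g (Field ?\<mu>)"
  proof
    assume "inj_on g (Field ?\<mu>)"
    then have "|Field ?\<mu>| \<le>o |{ys :: ('a + nat) list. length ys = length xs}|"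
      by (rule card_of_ordLeqI) (simp add: g_def)
    also have "|{ys :: ('a + nat) list. length ys = length xs}| \<le>o |UNIV :: ('a + nat) set|"
      by (rule card_of_lists_length) (simp add: finite_Plus_UNIV_iff)
    finally have "|Field ?\<mu>| \<le>o |UNIV :: ('a + nat) set|" .
    moreover have "?\<mu> =o |Field ?\<mu>|"
      using card_of_Field_ordIso[OF co] by (rule ordIso_symmetric)
    ultimately have "?\<mu> \<le>o |UNIV :: ('a + nat) set|"
      using ordIso_ordLeq_trans by blast
    moreover have "|UNIV :: ('a + nat) set| <o ?\<mu>"
      by (simp add: cardSuc_greater card_of_Card_order)
    ultimately show False
      using not_ordLess_ordLeq by blast
  qed
  then obtain i' j' where ij': "i' \<in> Field ?\<mu>" "j' \<in> Field ?\<mu>" "i' \<noteq> j'" "g i' = g j'"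
    by (auto simp: inj_on_def)
  have "total_on (Field ?\<mu>) ?\<mu>"
    using co by (simp add: card_order_on_def well_order_on_def linear_order_on_def)
  then obtain i j where ij: "i \<in> Field ?\<mu>" "j \<in> Field ?\<mu>" "(i, j) \<in> ?\<mu>" "i \<noteq> j" "g i = g j"
    using ij' unfolding total_on_def by metis
  have fij: "f i x = f j x" if "x \<in> carrier F" for x
    using ij(5) that xs by (auto simp: g_def)
  have iso: "f i \<in> Group.iso F (G\<lparr>carrier := S i\<rparr>)" "f j \<in> Group.iso F (G\<lparr>carrier := S j\<rparr>)"
    using A ij by auto
  have Si: "f i ` carrier F = S i" and Sj: "f j ` carrier F = S j" and inj: "inj_on (f i) (carrier F)"
    using iso by (auto simp: Group.iso_def bij_betw_def)
  have SS: "S j = S i"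
    using Si Sj fij by auto
  have "subgroup (S i) G"
    using A ij by auto
  then have gen: "generate G (S i \<union> S j) = S i"
    using generateI[of "S i" "S i"] SS by auto
  interpret F: group F using A by blast
  have "inv_into (carrier F) (f i) \<in> hom (G\<lparr>carrier := generate G (S i \<union> S j)\<rparr>) F"
    using F.iso_set_sym[OF iso(1)] by (simp add: gen Group.iso_def)
  moreover have "inv_into (carrier F) (f i) (f i x) = x \<and> inv_into (carrier F) (f i) (f j x) = x"
    if "x \<in> carrier F" for x
    using inj that fij[OF that, symmetric] by simp
  ultimately show "\<exists>i j \<phi>. (i, j) \<in> ?\<mu> \<and> i \<noteq> j \<and>
      \<phi> \<in> hom (G\<lparr>carrier := generate G (S i \<union> S j)\<rparr>) F \<and>
      (\<forall>x\<in>carrier F. \<phi> (f i x) = x \<and> \<phi> (f j x) = x)"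
    using ij by blast
qed

lemma compat_number:
  fixes G :: "('a, 'm) monoid_scheme"
  assumes "group G"
  shows "Cinfinite (compat_number G)" "weak_compat G (cardSuc (compat_number G))"
    "\<And>\<kappa> :: 'k rel. Cinfinite \<kappa> \<Longrightarrow> weak_compat G (cardSuc \<kappa>) \<Longrightarrow> compat_number G \<le>o \<kappa>"
proof -
  let ?U = "|UNIV :: ('a + nat) set|"
  let ?R = "{\<kappa> :: ('a + nat) rel. Cinfinite \<kappa> \<and> weak_compat G (cardSuc \<kappa>)}"
  have U: "?U \<in> ?R"
    using weak_compat_UNIV[OF assms]
    by (auto simp: cinfinite_def Field_card_of finite_Plus_UNIV_iff card_of_card_order_on)
  then have "?R \<noteq> {}" by blast
  note lc = least_card[OF this, folded compat_number_def]
  show "Cinfinite (compat_number G)" "weak_compat G (cardSuc (compat_number G))"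
    using lc(1) by auto
  fix \<kappa> :: "'k rel"
  assume \<kappa>: "Cinfinite \<kappa>" and wc: "weak_compat G (cardSuc \<kappa>)"
  have wo: "Well_order \<kappa>" "Well_order ?U"
    using \<kappa> card_of_Well_order by (auto simp: card_order_on_def)
  show "compat_number G \<le>o \<kappa>"
  proof (cases "?U \<le>o \<kappa>")
    case True
    moreover have "compat_number G \<le>o ?U"
      using lc(2) U by blast
    ultimately show ?thesis
      using ordLeq_transitive by blast
  next
    case False
    then have "\<kappa> \<le>o ?U"
      using ordLeq_total[OF wo] by blast
    have F\<kappa>: "|Field \<kappa>| =o \<kappa>"
      using \<kappa> by (intro card_of_Field_ordIso) blast
    from F\<kappa> \<open>\<kappa> \<le>o ?U\<close> have "|Field \<kappa>| \<le>o ?U"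
      by (rule ordIso_ordLeq_trans)
    then obtain h :: "'k \<Rightarrow> 'a + nat" where "inj_on h (Field \<kappa>)"
      unfolding card_of_ordLeq[symmetric] by blast
    then have "|Field \<kappa>| =o |h ` Field \<kappa>|"
      by (rule card_of_ordIsoI[OF inj_on_imp_bij_betw])
    with ordIso_symmetric[OF F\<kappa>] have eq: "\<kappa> =o |h ` Field \<kappa>|"
      by (rule ordIso_transitive)
    then have "cardSuc \<kappa> =o cardSuc |h ` Field \<kappa>|"
      using \<kappa> by (simp add: cardSuc_invar_ordIso card_of_Card_order)
    from weak_compat_ordIso[OF this wc]
    have "|h ` Field \<kappa>| \<in> ?R"
      using Cinfinite_cong[OF eq \<kappa>] by blast
    then have "compat_number G \<le>o |h ` Field \<kappa>|"
      by (rule lc(2)[rotated]) auto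
    then show ?thesis
      using ordIso_symmetric[OF eq] by (rule ordLeq_ordIso_trans)
  qed
qed

lemma weight:
  "\<exists>B. topology_base X B \<and> weight X = |B|" "\<And>B. topology_base X B \<Longrightarrow> weight X \<le>o |B|"
proof -
  have "topology_base X {U. openin X U}"
    by (auto simp: topology_base_def)
  then have "{|B| | B. topology_base X B} \<noteq> {}" by blast
  moreover have "\<And>r. r \<in> {|B| | B. topology_base X B} \<Longrightarrow> Card_order r"
    using card_of_Card_order by blast
  ultimately have lc: "weight X \<in> {|B| | B. topology_base X B}"
      "\<And>s. s \<in> {|B| | B. topology_base X B} \<Longrightarrow> weight X \<le>o s"
    unfolding weight_def by (rule least_card; blast)+
  show "\<exists>B. topology_base X B \<and> weight X = |B|"
    using lc(1) by blast
  show "\<And>B. topology_base X B \<Longrightarrow> weight X \<le>o |B|"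
    using lc(2) by blast
qed

lemma linear_weight:
  fixes G :: "('a, 'm) monoid_scheme"
  assumes "group G"
  shows "\<exists>X. linear_group_topology G X \<and> Hausdorff_space X \<and> linear_weight G = weight X"
    "\<And>X. linear_group_topology G X \<Longrightarrow> Hausdorff_space X \<Longrightarrow> linear_weight G \<le>o weight X"
proof -
  interpret group G by fact
  let ?X = "discrete_topology (carrier G)"
  have "linear_group_topology G ?X"
    unfolding linear_group_topology_def group_topology_def
    using triv_subgroup
    by (auto simp flip: prod_topology_discrete_topology)
  then have ne: "{weight X | X. linear_group_topology G X \<and> Hausdorff_space X} \<noteq> {}"
    using Hausdorff_space_discrete_topology by blast
  have co: "Card_order (weight X)" for X :: "'a topology"
    using weight(1)[of X] card_of_Card_order by metis
  note lc = least_card[OF ne, folded linear_weight_def]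
  show "\<exists>X. linear_group_topology G X \<and> Hausdorff_space X \<and> linear_weight G = weight X"
    using lc(1) co by blast
  show "\<And>X. linear_group_topology G X \<Longrightarrow> Hausdorff_space X \<Longrightarrow> linear_weight G \<le>o weight X"
    using lc(2) co by blast
qed

end

theory Submission
  imports Defs
begin

text \<open>
  Let \<open>\<tau>\<close> be a linear Hausdorff group topology on \<open>G\<close> of least weight, and let \<open>B\<close> be a base of
  \<open>\<tau>\<close> with \<open>|B| = \<kappa>\<close>; it is infinite because \<open>G\<close> is.  Given isomorphisms \<open>f\<^sub>i : F \<rightarrow> F\<^sub>i\<close> for
  \<open>i < \<kappa>\<^sup>+\<close>, the Hausdorff property and linearity yield an open subgroup meeting the finite group
  \<open>F\<^sub>i\<close> trivially.  That subgroup need not be normal, but intersecting its finitely many conjugates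
  by elements of \<open>F\<^sub>i\<close> gives an open subgroup \<open>K\<^sub>i\<close> that is normalised by \<open>F\<^sub>i\<close> and still meets it
  trivially.  Hence \<open>F\<^sub>i K\<^sub>i\<close> is a semidirect product, and \<open>f\<^sub>i x k \<mapsto> x\<close> is a homomorphism from it
  to \<open>F\<close> (\<open>normalised_complement_retraction\<close>).

  This homomorphism is what is needed for the pair \<open>i, j\<close> as soon as \<open>f\<^sub>j x \<in> f\<^sub>i x K\<^sub>i\<close> for all
  \<open>x \<in> F\<close>, since then \<open>F\<^sub>j\<close> lies in \<open>F\<^sub>i K\<^sub>i\<close>.  To find such a pair, choose basic open sets
  \<open>B\<^sub>i\<^sub>x\<close> with \<open>f\<^sub>i x \<in> B\<^sub>i\<^sub>x \<subseteq> f\<^sub>i x K\<^sub>i\<close>.  There are only \<open>\<kappa>\<close> many families \<open>(B\<^sub>i\<^sub>x)\<^sub>x\<close> indexed by the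
  finite set \<open>F\<close>, so two indices \<open>i \<noteq> j\<close> share the same one (\<open>cardSuc_pigeonhole\<close>), and then
  \<open>f\<^sub>j x \<in> B\<^sub>j\<^sub>x = B\<^sub>i\<^sub>x \<subseteq> f\<^sub>i x K\<^sub>i\<close>.
\<close>

section \<open>Counting finite families\<close>

lemma card_of_lists_over_length:
  assumes "infinite A"
  shows "|{xs. set xs \<subseteq> A \<and> length xs = n}| \<le>o |A|"
proof (induction n)
  case 0
  obtain a where "a \<in> A"
    using assms infinite_imp_nonempty by blast
  then show ?case
    by (intro card_of_ordLeqI[where f = "\<lambda>_. a"]) (auto simp: inj_on_def)
next
  case (Suc n)
  let ?L = "\<lambda>n. {xs. set xs \<subseteq> A \<and> length xs = n}"
  have "|?L (Suc n)| \<le>o |A \<times> ?L n|"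
  proof (rule card_of_ordLeqI[where f = "\<lambda>xs. (hd xs, tl xs)"])
    show "inj_on (\<lambda>xs. (hd xs, tl xs)) (?L (Suc n))"
    proof (rule inj_onI)
      fix xs ys assume "xs \<in> ?L (Suc n)" "ys \<in> ?L (Suc n)" "(hd xs, tl xs) = (hd ys, tl ys)"
      then show "xs = ys"
        by (cases xs; cases ys) auto
    qed
    show "(hd xs, tl xs) \<in> A \<times> ?L n" if "xs \<in> ?L (Suc n)" for xs
      using that by (cases xs) auto
  qed
  also have "|A \<times> ?L n| \<le>o |A|"
    by (rule card_of_Times_ordLeq_infinite_Field)
      (use assms Suc.IH in \<open>simp_all add: Field_card_of card_of_mono1 card_of_card_order_on\<close>)
  finally show ?case .
qed

text \<open>Listing the values \<open>c i p\<close> in a fixed order of \<open>P\<close> turns the family indexed by \<open>i\<close> into a list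
  of fixed length over \<open>B\<close>, and there are fewer such lists than indices.\<close>

lemma cardSuc_pigeonhole:
  assumes B: "infinite B" and P: "finite P"
    and c: "\<And>i p. i \<in> Field (cardSuc |B| ) \<Longrightarrow> p \<in> P \<Longrightarrow> c i p \<in> B"
  obtains i j where "(i, j) \<in> cardSuc |B|" "i \<noteq> j" "\<And>p. p \<in> P \<Longrightarrow> c i p = c j p"
proof -
  let ?\<mu> = "cardSuc |B|"
  have co: "Card_order ?\<mu>"
    by (simp add: cardSuc_Card_order card_of_Card_order)
  obtain ps where ps: "set ps = P"
    using P finite_list by blast
  have "\<not> inj_on (\<lambda>i. map (c i) ps) (Field ?\<mu>)"
  proof
    assume "inj_on (\<lambda>i. map (c i) ps) (Field ?\<mu>)"
    then have "|Field ?\<mu>| \<le>o |{xs. set xs \<subseteq> B \<and> length xs = length ps}|"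
      by (rule card_of_ordLeqI) (use c ps in auto)
    also have "|{xs. set xs \<subseteq> B \<and> length xs = length ps}| \<le>o |B|"
      by (rule card_of_lists_over_length[OF B])
    finally have "?\<mu> \<le>o |B|"
      using card_of_Field_ordIso[OF co] ordIso_symmetric ordIso_ordLeq_trans by blast
    moreover have "|B| <o ?\<mu>"
      by (simp add: cardSuc_greater card_of_Card_order)
    ultimately show False
      using not_ordLess_ordLeq by blast
  qed
  then obtain i j where ij: "i \<in> Field ?\<mu>" "j \<in> Field ?\<mu>" "i \<noteq> j" "map (c i) ps = map (c j) ps"
    by (auto simp: inj_on_def)
  have eq: "c i p = c j p" if "p \<in> P" for p
    using ij(4) ps that by auto
  have "total_on (Field ?\<mu>) ?\<mu>"
    using co by (simp add: card_order_on_def well_order_on_def linear_order_on_def)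
  then have "(i, j) \<in> ?\<mu> \<or> (j, i) \<in> ?\<mu>"
    using ij by (auto simp: total_on_def)
  then show thesis
    using that[of i j] that[of j i] ij(3) eq by metis
qed

text \<open>The basic open sets containing a point determine that point.\<close>

lemma infinite_topology_base:
  assumes X: "t1_space X" "infinite (topspace X)" and B: "topology_base X B"
  shows "infinite B"
proof
  assume "finite B"
  have "inj_on (\<lambda>x. {V \<in> B. x \<in> V}) (topspace X)"
  proof (rule inj_onI, rule ccontr)
    fix x y
    assume xy: "x \<in> topspace X" "y \<in> topspace X" "{V \<in> B. x \<in> V} = {V \<in> B. y \<in> V}" "x \<noteq> y"
    then obtain U where "openin X U" "x \<in> U" "y \<notin> U"
      using X(1) unfolding t1_space_def by blast
    then obtain V where "V \<in> B" "x \<in> V" "V \<subseteq> U"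
      using B unfolding topology_base_def by blast
    with xy(3) \<open>y \<notin> U\<close> show False by blast
  qed
  moreover have "(\<lambda>x. {V \<in> B. x \<in> V}) ` topspace X \<subseteq> Pow B"
    by auto
  ultimately have "finite (topspace X)"
    using \<open>finite B\<close> by (meson finite_Pow_iff inj_on_finite)
  with X(2) show False ..
qed

section \<open>Subgroups normalised by a finite subgroup\<close>

text \<open>When \<open>H\<close> is a subgroup, \<open>conjugate_core G S H\<close> is the intersection of the conjugates
  \<open>s H s\<^sup>-\<^sup>1\<close> with \<open>s \<in> S\<close>.  Membership in \<open>carrier G\<close> is imposed separately so that it makes sense
  for empty \<open>S\<close> as well.\<close>

definition conjugate_core :: "('a, 'm) monoid_scheme \<Rightarrow> 'a set \<Rightarrow> 'a set \<Rightarrow> 'a set" where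
  "conjugate_core G S H =
     {k \<in> carrier G. \<forall>s\<in>S. inv\<^bsub>G\<^esub> s \<otimes>\<^bsub>G\<^esub> k \<otimes>\<^bsub>G\<^esub> s \<in> H}"

context group
begin

lemma conj_mult:
  assumes "s \<in> carrier G" "a \<in> carrier G" "b \<in> carrier G"
  shows "inv s \<otimes> (a \<otimes> b) \<otimes> s = (inv s \<otimes> a \<otimes> s) \<otimes> (inv s \<otimes> b \<otimes> s)"
proof -
  have "s \<otimes> (inv s \<otimes> (b \<otimes> s)) = b \<otimes> s"
    using assms by (simp add: m_assoc[symmetric])
  then show ?thesis
    using assms by (simp add: m_assoc)
qed

lemma conj_inv:
  assumes "s \<in> carrier G" "a \<in> carrier G"
  shows "inv s \<otimes> inv a \<otimes> s = inv (inv s \<otimes> a \<otimes> s)"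
  using assms by (simp add: inv_mult_group m_assoc)

lemma subgroup_conjugate_core:
  assumes S: "S \<subseteq> carrier G" and H: "subgroup H G"
  shows "subgroup (conjugate_core G S H) G"
proof (rule subgroupI)
  show "conjugate_core G S H \<subseteq> carrier G"
    by (auto simp: conjugate_core_def)
  have "\<one> \<in> conjugate_core G S H"
    using S subgroup.one_closed[OF H] by (auto simp: conjugate_core_def subset_iff)
  then show "conjugate_core G S H \<noteq> {}" by blast
next
  fix a assume a: "a \<in> conjugate_core G S H"
  then show "inv a \<in> conjugate_core G S H"
    using S conj_inv subgroup.m_inv_closed[OF H] by (auto simp: conjugate_core_def subset_iff)
next
  fix a b assume "a \<in> conjugate_core G S H" "b \<in> conjugate_core G S H"
  then show "a \<otimes> b \<in> conjugate_core G S H"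
    using S conj_mult subgroup.m_closed[OF H] by (auto simp: conjugate_core_def subset_iff)
qed

lemma conjugate_core_normalised:
  assumes S: "subgroup S G" and t: "t \<in> S" and k: "k \<in> conjugate_core G S H"
  shows "inv t \<otimes> k \<otimes> t \<in> conjugate_core G S H"
proof -
  have c: "t \<in> carrier G" "k \<in> carrier G"
    using subgroup.subset[OF S] t k by (auto simp: conjugate_core_def)
  have "inv s \<otimes> (inv t \<otimes> k \<otimes> t) \<otimes> s \<in> H" if "s \<in> S" for s
  proof -
    have "inv s \<otimes> (inv t \<otimes> k \<otimes> t) \<otimes> s = inv (t \<otimes> s) \<otimes> k \<otimes> (t \<otimes> s)"
      using c that subgroup.subset[OF S] by (auto simp: inv_mult_group m_assoc subset_iff)
    moreover have "t \<otimes> s \<in> S"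
      using subgroup.m_closed[OF S t that] .
    ultimately show ?thesis
      using k by (simp add: conjugate_core_def)
  qed
  then show ?thesis
    using c by (simp add: conjugate_core_def)
qed

text \<open>If \<open>S\<close> normalises \<open>K\<close> and meets it trivially, then \<open>S K\<close> is a semidirect product; the
  homomorphism is the projection onto the factor \<open>S\<close>, read in \<open>F\<close>.\<close>

lemma normalised_complement_retraction:
  assumes S: "subgroup S G" and K: "subgroup K G"
    and norm: "\<And>s k. s \<in> S \<Longrightarrow> k \<in> K \<Longrightarrow> inv s \<otimes> k \<otimes> s \<in> K"
    and triv: "S \<inter> K \<subseteq> {\<one>}"
    and F: "group F" and f: "f \<in> Group.iso F (G\<lparr>carrier := S\<rparr>)"
  obtains \<phi> where "subgroup (S <#> K) G" "\<phi> \<in> hom (G\<lparr>carrier := S <#> K\<rparr>) F"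
    "\<And>x k. x \<in> carrier F \<Longrightarrow> k \<in> K \<Longrightarrow> \<phi> (f x \<otimes> k) = x"
proof -
  interpret F: group F by (rule F)
  have Sc: "\<And>s. s \<in> S \<Longrightarrow> s \<in> carrier G" and Kc: "\<And>k. k \<in> K \<Longrightarrow> k \<in> carrier G"
    using subgroup.subset[OF S] subgroup.subset[OF K] by auto
  have fS: "f ` carrier F = S" and inj: "inj_on f (carrier F)"
    and fmult: "\<And>x y. x \<in> carrier F \<Longrightarrow> y \<in> carrier F \<Longrightarrow> f (x \<otimes>\<^bsub>F\<^esub> y) = f x \<otimes> f y"
    using f by (auto simp: Group.iso_def hom_def bij_betw_def)
  \<comment> \<open>The multiplication rule of a semidirect product.\<close>
  have prod: "(s \<otimes> k) \<otimes> (t \<otimes> l) = (s \<otimes> t) \<otimes> ((inv t \<otimes> k \<otimes> t) \<otimes> l)"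
    if "s \<in> S" "t \<in> S" "k \<in> K" "l \<in> K" for s t k l
  proof -
    have "t \<otimes> (inv t \<otimes> (k \<otimes> (t \<otimes> l))) = k \<otimes> (t \<otimes> l)"
      using that Sc Kc by (simp add: m_assoc[symmetric])
    then show ?thesis
      using that Sc Kc by (simp add: m_assoc)
  qed
  have uniq: "s = t" if "s \<in> S" "t \<in> S" "k \<in> K" "l \<in> K" "s \<otimes> k = t \<otimes> l" for s t k l
  proof -
    have c: "s \<in> carrier G" "t \<in> carrier G" "k \<in> carrier G" "l \<in> carrier G"
      using that Sc Kc by auto
    have "inv t \<otimes> s = inv t \<otimes> (s \<otimes> k) \<otimes> inv k"
      using c by (simp add: m_assoc)
    also have "\<dots> = l \<otimes> inv k"
      unfolding that(5) using c by (simp add: m_assoc[symmetric])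
    finally have eq: "inv t \<otimes> s = l \<otimes> inv k" .
    have "inv t \<otimes> s \<in> S"
      using that subgroup.m_closed[OF S] subgroup.m_inv_closed[OF S] by blast
    moreover have "inv t \<otimes> s \<in> K"
      unfolding eq using that subgroup.m_closed[OF K] subgroup.m_inv_closed[OF K] by blast
    ultimately have one: "inv t \<otimes> s = \<one>"
      using triv by blast
    have "s = t \<otimes> (inv t \<otimes> s)"
      using c by (simp add: m_assoc[symmetric])
    then show ?thesis
      using c by (simp add: one)
  qed
  have sub: "subgroup (S <#> K) G"
  proof (rule subgroupI)
    show "S <#> K \<subseteq> carrier G"
      using Sc Kc by (auto simp: set_mult_def)
    show "S <#> K \<noteq> {}"
      using subgroup.one_closed[OF S] subgroup.one_closed[OF K] by (auto simp: set_mult_def)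
  next
    fix a assume "a \<in> S <#> K"
    then obtain s k where sk: "s \<in> S" "k \<in> K" "a = s \<otimes> k"
      by (auto simp: set_mult_def)
    have si: "inv s \<in> S" and ki: "inv k \<in> K"
      using sk S K by (auto intro: subgroup.m_inv_closed)
    have "inv a = inv s \<otimes> (inv (inv s) \<otimes> inv k \<otimes> inv s)"
      using sk Sc Kc by (simp add: inv_mult_group m_assoc[symmetric])
    then show "inv a \<in> S <#> K"
      using norm[OF si ki] si by (auto simp: set_mult_def)
  next
    fix a b assume "a \<in> S <#> K" "b \<in> S <#> K"
    then obtain s k t l where sk: "s \<in> S" "k \<in> K" "a = s \<otimes> k" "t \<in> S" "l \<in> K" "b = t \<otimes> l"
      by (auto simp: set_mult_def)
    then have "s \<otimes> t \<in> S" "(inv t \<otimes> k \<otimes> t) \<otimes> l \<in> K"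
      using norm S K by (auto intro: subgroup.m_closed)
    then show "a \<otimes> b \<in> S <#> K"
      using prod[of s t k l] sk by (auto simp: set_mult_def)
  qed
  define \<phi> where "\<phi> g = (THE x. x \<in> carrier F \<and> (\<exists>k\<in>K. g = f x \<otimes> k))" for g
  have \<phi>: "\<phi> (f x \<otimes> k) = x" if "x \<in> carrier F" "k \<in> K" for x k
    unfolding \<phi>_def
  proof (rule the_equality)
    show "x \<in> carrier F \<and> (\<exists>l\<in>K. f x \<otimes> k = f x \<otimes> l)"
      using that by blast
    fix y assume y: "y \<in> carrier F \<and> (\<exists>l\<in>K. f x \<otimes> k = f y \<otimes> l)"
    then obtain l where "l \<in> K" "f x \<otimes> k = f y \<otimes> l" by blast
    then have "f x = f y"
      using uniq[of "f x" "f y" k l] that y fS by blast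
    then show "y = x"
      using inj that y by (auto dest: inj_onD)
  qed
  have dec: "\<exists>x\<in>carrier F. \<exists>k\<in>K. a = f x \<otimes> k" if "a \<in> S <#> K" for a
    using that fS by (auto simp: set_mult_def)
  have "\<phi> \<in> hom (G\<lparr>carrier := S <#> K\<rparr>) F"
  proof (rule homI)
    fix a assume "a \<in> carrier (G\<lparr>carrier := S <#> K\<rparr>)"
    then show "\<phi> a \<in> carrier F"
      using dec[of a] \<phi> by auto
  next
    fix a b
    assume "a \<in> carrier (G\<lparr>carrier := S <#> K\<rparr>)" "b \<in> carrier (G\<lparr>carrier := S <#> K\<rparr>)"
    then obtain x k y l where xk: "x \<in> carrier F" "k \<in> K" "a = f x \<otimes> k"
      and yl: "y \<in> carrier F" "l \<in> K" "b = f y \<otimes> l"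
      using dec[of a] dec[of b] by auto
    have S': "f x \<in> S" "f y \<in> S"
      using xk yl fS by auto
    have K': "(inv (f y) \<otimes> k \<otimes> f y) \<otimes> l \<in> K"
      using norm[OF S'(2) xk(2)] yl(2) by (rule subgroup.m_closed[OF K])
    have "a \<otimes> b = f (x \<otimes>\<^bsub>F\<^esub> y) \<otimes> ((inv (f y) \<otimes> k \<otimes> f y) \<otimes> l)"
      using prod[OF S' xk(2) yl(2)] fmult xk yl by simp
    then have "\<phi> (a \<otimes> b) = x \<otimes>\<^bsub>F\<^esub> y"
      using \<phi> K' xk yl by simp
    then show "\<phi> (a \<otimes>\<^bsub>G\<lparr>carrier := S <#> K\<rparr>\<^esub> b) = \<phi> a \<otimes>\<^bsub>F\<^esub> \<phi> b"
      using \<phi> xk yl by simp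
  qed
  with sub \<phi> show thesis
    using that by blast
qed

section \<open>Small open subgroups\<close>

lemma group_topology_continuous_translations:
  assumes X: "group_topology G X" and a: "a \<in> carrier G"
  shows "continuous_map X X (\<lambda>g. a \<otimes> g)" "continuous_map X X (\<lambda>g. g \<otimes> a)"
proof -
  have ts: "topspace X = carrier G"
    and div: "continuous_map (prod_topology X X) X (\<lambda>(x, y). x \<otimes> inv y)"
    using X by (auto simp: group_topology_def)
  have div': "continuous_map X X (\<lambda>g. p g \<otimes> inv q g)"
    if "continuous_map X X p" "continuous_map X X q" for p q
    using continuous_map_compose[OF _ div, of X "\<lambda>g. (p g, q g)"] that
    by (simp add: continuous_map_pairwise o_def)
  have const: "continuous_map X X (\<lambda>_. b)" if "b \<in> carrier G" for b
    using that ts by simp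
  have inv: "continuous_map X X (\<lambda>g. \<one> \<otimes> inv g)"
    using div'[OF const[of \<one>], of "\<lambda>g. g"] by simp
  have "continuous_map X X (\<lambda>g. a \<otimes> inv (\<one> \<otimes> inv g))"
    by (rule div'[OF const[OF a] inv])
  then show "continuous_map X X (\<lambda>g. a \<otimes> g)"
    by (rule continuous_map_eq) (simp add: ts)
  have "continuous_map X X (\<lambda>g. g \<otimes> inv (inv a))"
    by (rule div'[OF _ const]) (use a in simp_all)
  then show "continuous_map X X (\<lambda>g. g \<otimes> a)"
    using a by simp
qed

lemma openin_left_coset:
  assumes X: "group_topology G X" and K: "openin X K" and a: "a \<in> carrier G"
  shows "openin X {g \<in> carrier G. inv a \<otimes> g \<in> K}"
proof -
  have "topspace X = carrier G"
    using X by (simp add: group_topology_def)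
  with openin_continuous_map_preimage[OF
      group_topology_continuous_translations(1)[OF X inv_closed[OF a]] K]
  show ?thesis
    by simp
qed

lemma openin_conjugate_core:
  assumes X: "group_topology G X" and H: "openin X H"
    and S: "finite S" "S \<subseteq> carrier G"
  shows "openin X (conjugate_core G S H)"
proof -
  have ts: "topspace X = carrier G"
    using X by (simp add: group_topology_def)
  have "openin X {k \<in> carrier G. inv s \<otimes> k \<otimes> s \<in> H}" if "s \<in> S" for s
  proof -
    have s: "s \<in> carrier G"
      using that S by auto
    have "continuous_map X X ((\<lambda>g. g \<otimes> s) \<circ> (\<lambda>g. inv s \<otimes> g))"
      using group_topology_continuous_translations[OF X] s
      by (intro continuous_map_compose[of X X _ X]) auto
    from openin_continuous_map_preimage[OF this H] show ?thesis
      by (simp add: ts)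
  qed
  then have "openin X ((\<Inter>s\<in>S. {k \<in> carrier G. inv s \<otimes> k \<otimes> s \<in> H}) \<inter> topspace X)"
    by (intro openin_INT S(1))
  also have "(\<Inter>s\<in>S. {k \<in> carrier G. inv s \<otimes> k \<otimes> s \<in> H}) \<inter> topspace X = conjugate_core G S H"
    by (auto simp: conjugate_core_def ts)
  finally show ?thesis .
qed

text \<open>Finite sets are closed, so the set \<open>S\<close> without the unit can be avoided by a neighbourhood of
  the unit, and hence by an open subgroup; passing to the conjugate core makes it normalised.\<close>

lemma open_normalised_complement:
  assumes X: "linear_group_topology G X" "t1_space X" and S: "subgroup S G" "finite S"
  obtains K where "subgroup K G" "openin X K" "S \<inter> K \<subseteq> {\<one>}"
    "\<And>s k. s \<in> S \<Longrightarrow> k \<in> K \<Longrightarrow> inv s \<otimes> k \<otimes> s \<in> K"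
proof -
  have gt: "group_topology G X" and ts: "topspace X = carrier G"
    using X by (auto simp: linear_group_topology_def group_topology_def)
  have Sc: "S \<subseteq> carrier G"
    by (rule subgroup.subset[OF S(1)])
  have "closedin X (S - {\<one>})"
    using X(2) S(2) Sc ts by (auto simp: t1_space_closedin_finite)
  then have "openin X (carrier G - (S - {\<one>}))"
    by (simp add: closedin_def ts)
  moreover have "\<one> \<in> carrier G - (S - {\<one>})"
    by simp
  ultimately obtain H where H: "subgroup H G" "openin X H" "H \<subseteq> carrier G - (S - {\<one>})"
    using X(1) unfolding linear_group_topology_def by blast
  show thesis
  proof (rule that)
    show "subgroup (conjugate_core G S H) G"
      by (rule subgroup_conjugate_core[OF Sc H(1)])
    show "openin X (conjugate_core G S H)"
      by (rule openin_conjugate_core[OF gt H(2) S(2) Sc])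
    have "conjugate_core G S H \<subseteq> H"
      \<comment> \<open>The conjugate by \<open>\<one> \<in> S\<close> is \<open>H\<close> itself.\<close>
      using subgroup.one_closed[OF S(1)] by (force simp: conjugate_core_def)
    then show "S \<inter> conjugate_core G S H \<subseteq> {\<one>}"
      using H(3) by blast
    show "inv s \<otimes> k \<otimes> s \<in> conjugate_core G S H" if "s \<in> S" "k \<in> conjugate_core G S H" for s k
      using conjugate_core_normalised[OF S(1) that] .
  qed
qed

section \<open>Weak compatibility from a base\<close>

text \<open>Only one of the two indices needs a complement adapted to it: the projection along \<open>K i\<close> is
  the identity on \<open>F\<close> after \<open>f i\<close> by construction, and after \<open>f j\<close> because \<open>f j x\<close> and \<open>f i x\<close> lie
  in the same left coset of \<open>K i\<close>.  All complements are nevertheless chosen in advance, as the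
  pigeonhole principle decides which pair of indices is used.\<close>

lemma weak_compat_cardSuc_base:
  assumes X: "linear_group_topology G X" "t1_space X"
    and B: "topology_base X B" "infinite B"
  shows "weak_compat G (cardSuc |B| )"
  unfolding weak_compat_def
proof (intro allI impI)
  let ?\<mu> = "cardSuc |B|"
  fix F :: "nat monoid" and S f
  assume A: "group F \<and> finite (carrier F) \<and>
    (\<forall>i\<in>Field ?\<mu>. subgroup (S i) G \<and> finite (S i) \<and> f i \<in> Group.iso F (G\<lparr>carrier := S i\<rparr>))"
  have gt: "group_topology G X"
    using X(1) by (simp add: linear_group_topology_def)
  have sub: "subgroup (S i) G" and fin: "finite (S i)"
    and f: "f i \<in> Group.iso F (G\<lparr>carrier := S i\<rparr>)" if "i \<in> Field ?\<mu>" for i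
    using A that by auto
  have fS: "f i ` carrier F = S i" if "i \<in> Field ?\<mu>" for i
    using f[OF that] by (auto simp: Group.iso_def bij_betw_def)
  then have fc: "f i x \<in> carrier G" if "i \<in> Field ?\<mu>" "x \<in> carrier F" for i x
    using subgroup.subset[OF sub[OF that(1)]] that by blast
  have "\<exists>K. subgroup K G \<and> openin X K \<and> S i \<inter> K \<subseteq> {\<one>} \<and>
      (\<forall>s\<in>S i. \<forall>k\<in>K. inv s \<otimes> k \<otimes> s \<in> K)" if "i \<in> Field ?\<mu>" for i
    by (rule open_normalised_complement[OF X sub[OF that] fin[OF that]]) blast
  then obtain K where K: "\<And>i. i \<in> Field ?\<mu> \<Longrightarrow> subgroup (K i) G \<and> openin X (K i) \<and>
      S i \<inter> K i \<subseteq> {\<one>} \<and> (\<forall>s\<in>S i. \<forall>k\<in>K i. inv s \<otimes> k \<otimes> s \<in> K i)"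
    by metis
  have "\<exists>V\<in>B. f i x \<in> V \<and> V \<subseteq> {g \<in> carrier G. inv (f i x) \<otimes> g \<in> K i}"
    if "i \<in> Field ?\<mu>" "x \<in> carrier F" for i x
  proof -
    have "f i x \<in> {g \<in> carrier G. inv (f i x) \<otimes> g \<in> K i}"
      using fc[OF that] K[OF that(1)] by (simp add: subgroup.one_closed)
    moreover have "openin X {g \<in> carrier G. inv (f i x) \<otimes> g \<in> K i}"
      using openin_left_coset[OF gt _ fc[OF that]] K[OF that(1)] by blast
    ultimately show ?thesis
      using B(1) unfolding topology_base_def by blast
  qed
  then obtain V where V: "\<And>i x. i \<in> Field ?\<mu> \<Longrightarrow> x \<in> carrier F \<Longrightarrow>
      V i x \<in> B \<and> f i x \<in> V i x \<and> V i x \<subseteq> {g \<in> carrier G. inv (f i x) \<otimes> g \<in> K i}"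
    by metis
  have finF: "finite (carrier F)" and F: "group F"
    using A by auto
  have VB: "\<And>i x. i \<in> Field ?\<mu> \<Longrightarrow> x \<in> carrier F \<Longrightarrow> V i x \<in> B"
    using V by blast
  obtain i j where ij: "(i, j) \<in> ?\<mu>" "i \<noteq> j"
    and eq: "\<And>x. x \<in> carrier F \<Longrightarrow> V i x = V j x"
    by (rule cardSuc_pigeonhole[OF B(2) finF VB]) blast+
  have i: "i \<in> Field ?\<mu>" and j: "j \<in> Field ?\<mu>"
    using ij(1) by (auto simp: Field_def)
  have near: "\<exists>k\<in>K i. f j x = f i x \<otimes> k" if "x \<in> carrier F" for x
  proof
    show "inv (f i x) \<otimes> f j x \<in> K i"
      using V[OF i that] V[OF j that] eq[OF that] by auto
    show "f j x = f i x \<otimes> (inv (f i x) \<otimes> f j x)"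
      using fc[OF i that] fc[OF j that] by (simp add: m_assoc[symmetric])
  qed
  obtain \<phi> where sg: "subgroup (S i <#> K i) G" and hom: "\<phi> \<in> hom (G\<lparr>carrier := S i <#> K i\<rparr>) F"
    and \<phi>: "\<And>x k. x \<in> carrier F \<Longrightarrow> k \<in> K i \<Longrightarrow> \<phi> (f i x \<otimes> k) = x"
    by (rule normalised_complement_retraction[OF sub[OF i] _ _ _ F f[OF i], of "K i"])
      (use K[OF i] in blast)+
  have one: "\<one> \<in> K i"
    using K[OF i] by (simp add: subgroup.one_closed)
  have "S i \<subseteq> S i <#> K i"
    using one subgroup.subset[OF sub[OF i]] by (force simp: set_mult_def)
  moreover have "S j \<subseteq> S i <#> K i"
    using near fS[OF i] fS[OF j] by (fastforce simp: set_mult_def)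
  ultimately have "generate G (S i \<union> S j) \<subseteq> S i <#> K i"
    using generate_subgroup_incl[OF _ sg] by blast
  then have "\<phi> \<in> hom (G\<lparr>carrier := generate G (S i \<union> S j)\<rparr>) F"
    using hom by (auto simp: hom_def subset_iff)
  moreover have "\<phi> (f i x) = x \<and> \<phi> (f j x) = x" if "x \<in> carrier F" for x
    using \<phi>[OF that one] fc[OF i that] near[OF that] \<phi>[OF that] by auto
  ultimately show "\<exists>i j \<phi>. (i, j) \<in> ?\<mu> \<and> i \<noteq> j \<and>
      \<phi> \<in> hom (G\<lparr>carrier := generate G (S i \<union> S j)\<rparr>) F \<and>
      (\<forall>x\<in>carrier F. \<phi> (f i x) = x \<and> \<phi> (f j x) = x)"
    using ij by blast
qed

end

theorem proposition9:
  fixes G :: "('a, 'm) monoid_scheme"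
  assumes "group G" and "infinite (carrier G)"
  shows "compat_number G \<le>o linear_weight G"
proof -
  obtain X where X: "linear_group_topology G X" "Hausdorff_space X" "linear_weight G = weight X"
    using linear_weight(1)[OF assms(1)] by blast
  obtain B where B: "topology_base X B" "weight X = |B|"
    using weight(1) by blast
  have t1: "t1_space X"
    by (rule Hausdorff_imp_t1_space[OF X(2)])
  have "topspace X = carrier G"
    using X(1) by (simp add: linear_group_topology_def group_topology_def)
  then have inf: "infinite B"
    using infinite_topology_base[OF t1 _ B(1)] assms(2) by simp
  then have "Cinfinite |B|"
    by (simp add: cinfinite_def Field_card_of card_of_card_order_on)
  then have "compat_number G \<le>o |B|"
    using compat_number(3)[OF assms(1)] group.weak_compat_cardSuc_base[OF assms(1) X(1) t1 B(1) inf]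
    by blast
  then show ?thesis
    by (simp add: X(3) B(2))
qed

end
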